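(* Suppose $\varepsilon>0$. Then there exists a Lipschitz horizontal curve $\gamma\colon [0,1]\to \mathbb{R}^{4}$ in the Engel group such that for any $C^{1}$ horizontal curve $\Gamma\colon [0,1]\to \mathbb{R}^{4}$ in the Engel group, \[\mathcal{L}^{1}(\{t\in [0,1]:\gamma(t)=\Gamma(t)\})<\varepsilon.\]
   Context: $\mathcal{L}^1$ is Lebesgue measure on $\mathbb{R}$. Lipschitz means with respect to the Euclidean metric in both domain and target. The (first) Engel group is represented by $\mathbb{R}^4$ with coordinates $(x_1,x_2,x_3,x_4)$ and horizontal vector fields \[X_1=\partial_1,\qquad X_2=\partial_2+x_1\partial_3+\frac{x_1^2}{2}\partial_4 .\] An absolutely continuous curve $\gamma\colon[0,1]\to\mathbb{R}^4$ (in particular a Lipschitz or $C^1$ curve) is horizontal in the Engel group if, for almost every $t$, $\gamma'(t)$ is a linear combination of $X_1(\gamma(t))$ and $X_2(\gamma(t))$. *)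

theory Defs
  imports "HOL-Analysis.Analysis"
begin

definition engel_X1 :: "real^4 \<Rightarrow> real^4" where
  "engel_X1 p = axis 1 1"

definition engel_X2 :: "real^4 \<Rightarrow> real^4" where
  "engel_X2 p = axis 2 1 + (p $ 1) *\<^sub>R axis 3 1 + ((p $ 1)\<^sup>2 / 2) *\<^sub>R axis 4 1"

(* The classical epsilon-delta notion for curves, not the library's
   absolutely_continuous, which relates two measures. *)
definition absolutely_continuous_curve_on :: "real set \<Rightarrow> (real \<Rightarrow> 'a::metric_space) \<Rightarrow> bool" where
  "absolutely_continuous_curve_on S f \<longleftrightarrow>
     (\<forall>e>0. \<exists>d>0. \<forall>(n::nat) a b.
        (\<forall>i<n. a i \<le> b i \<and> {a i..b i} \<subseteq> S) \<and>
        disjoint_family_on (\<lambda>i. {a i<..<b i}) {..<n} \<and>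
        (\<Sum>i<n. b i - a i) < d \<longrightarrow>
        (\<Sum>i<n. dist (f (a i)) (f (b i))) < e)"

(* Curves on [0,1] are total functions whose values off [0,1] are irrelevant, so derivatives
   are taken within {0..1}: one-sided at the endpoints. The library's C1_differentiable_on
   would instead ask for two-sided derivatives there. *)
definition engel_horizontal :: "(real \<Rightarrow> real^4) \<Rightarrow> bool" where
  "engel_horizontal \<gamma> \<longleftrightarrow>
     absolutely_continuous_curve_on {0..1} \<gamma> \<and>
     (AE t in lebesgue_on {0..1}. \<exists>a b.
        (\<gamma> has_vector_derivative a *\<^sub>R engel_X1 (\<gamma> t) + b *\<^sub>R engel_X2 (\<gamma> t))
          (at t within {0..1}))"

definition C1_curve :: "(real \<Rightarrow> 'a::real_normed_vector) \<Rightarrow> bool" where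
  "C1_curve \<Gamma> \<longleftrightarrow>
     (\<exists>\<Gamma>'. (\<forall>t\<in>{0..1}. (\<Gamma> has_vector_derivative \<Gamma>' t) (at t within {0..1})) \<and>
           continuous_on {0..1} \<Gamma>')"

end

theory Submission
  imports Defs
begin

text \<open>A horizontal curve satisfies \<open>x3' = x1 * x2'\<close> and \<open>x4' = x1^2 / 2 * x2'\<close>. Hence the fourth
  coordinate cannot decrease while the second one increases. A \<open>C1\<close> curve whose second velocity is
  positive at one point keeps it positive nearby, and is bound by this constraint on a whole interval.
  A Lipschitz curve is not: it may have second velocity \<open>1\<close> at most times and still lose height in the
  fourth coordinate during short excursions in between.

  To make this precise, let \<open>U\<close> be a dense open set of measure less than \<open>\<epsilon>\<close>. Take for \<open>x1\<close> a
  differentiable function \<open>f\<close> that is positive on \<open>U\<close> and zero elsewhere, and let \<open>x2' = -1\<close> on \<open>U\<close> and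
  \<open>x2' = 1\<close> off \<open>U\<close>, that is, \<open>x2\<close> is \<open>t\<close> minus twice the measure of \<open>U \<inter> {0..t}\<close>. The horizontality
  equations then read \<open>x3' = - f\<close> and \<open>x4' = - f^2 / 2\<close>, and \<open>x4\<close> is strictly decreasing because
  \<open>U\<close> is dense. Suppose that a \<open>C1\<close> horizontal curve agrees with this one on a set \<open>B\<close> of times off \<open>U\<close>
  at which \<open>x2' = 1\<close>. At a limit point of \<open>B\<close> belonging to \<open>B\<close> its second velocity is \<open>1\<close>, so that
  its fourth coordinate is nondecreasing nearby; yet this coordinate is strictly smaller at the later of
  two nearby points of \<open>B\<close>. Hence \<open>B\<close> is discrete, thus countable
  (\<open>countable_agreement_at_unit_second_velocity\<close>), and the two curves agree on a set of
  measure at most that of \<open>U\<close>.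

  What remains is that \<open>x2' = 1\<close> holds almost everywhere off \<open>U\<close>, i.e. that \<open>U\<close> has density zero at
  almost every point outside it. Instead of the general density theorem, a specific \<open>U\<close> is used: the
  union of balls of radius \<open>\<rho> n ^ 3\<close> around a dense sequence, where \<open>\<rho>\<close> is summable. These balls are so
  small compared with the balls of radius \<open>\<rho> n\<close>, which still have finite total length, that the
  Borel-Cantelli lemma shows \<open>U\<close> to have measure of order \<open>(s - t)\<^sup>2\<close> between \<open>t\<close> and \<open>s\<close>, for
  almost every \<open>t\<close> off \<open>U\<close> (\<open>AE_summable_cube_over_square_distance\<close> and
  \<open>measure_initial_segment_derivative_outside\<close>).\<close>

section \<open>Horizontal curves with prescribed first two coordinates\<close>

lemma engel_X1_nth [simp]:
  "engel_X1 p $ 1 = 1" "engel_X1 p $ 2 = 0" "engel_X1 p $ 3 = 0" "engel_X1 p $ 4 = 0"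
  by (simp_all add: engel_X1_def axis_def)

lemma engel_X2_nth [simp]:
  "engel_X2 p $ 1 = 0" "engel_X2 p $ 2 = 1" "engel_X2 p $ 3 = p $ 1" "engel_X2 p $ 4 = (p $ 1)\<^sup>2 / 2"
  by (simp_all add: engel_X2_def axis_def)

lemma lipschitz_imp_absolutely_continuous_curve_on:
  fixes f :: "real \<Rightarrow> 'a::metric_space"
  assumes lip: "L-lipschitz_on S f"
  shows "absolutely_continuous_curve_on S f"
  unfolding absolutely_continuous_curve_on_def
proof (intro allI impI)
  fix e :: real assume "e > 0"
  have L0: "L \<ge> 0"
    using lip by (rule lipschitz_on_nonneg)
  show "\<exists>d>0. \<forall>(n::nat) a b.
        (\<forall>i<n. a i \<le> b i \<and> {a i..b i} \<subseteq> S) \<and>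
        disjoint_family_on (\<lambda>i. {a i<..<b i}) {..<n} \<and>
        (\<Sum>i<n. b i - a i) < d \<longrightarrow>
        (\<Sum>i<n. dist (f (a i)) (f (b i))) < e"
  proof (intro exI[of _ "e / (L + 1)"] conjI allI impI)
    show "e / (L + 1) > 0"
      using \<open>e > 0\<close> L0 by simp
  next
    fix n :: nat and a b :: "nat \<Rightarrow> real"
    assume *: "(\<forall>i<n. a i \<le> b i \<and> {a i..b i} \<subseteq> S) \<and>
        disjoint_family_on (\<lambda>i. {a i<..<b i}) {..<n} \<and>
        (\<Sum>i<n. b i - a i) < e / (L + 1)"
    have "dist (f (a i)) (f (b i)) \<le> L * (b i - a i)" if "i < n" for i
    proof -
      have "a i \<le> b i" "{a i..b i} \<subseteq> S"
        using * that by auto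
      then have "a i \<in> S" "b i \<in> S"
        by auto
      then have "dist (f (a i)) (f (b i)) \<le> L * dist (a i) (b i)"
        using lip by (auto intro: lipschitz_onD)
      with \<open>a i \<le> b i\<close> show ?thesis
        by (simp add: dist_real_def)
    qed
    then have "(\<Sum>i<n. dist (f (a i)) (f (b i))) \<le> (\<Sum>i<n. L * (b i - a i))"
      by (intro sum_mono) auto
    also have "\<dots> = L * (\<Sum>i<n. b i - a i)"
      by (simp add: sum_distrib_left)
    also have "\<dots> \<le> L * (e / (L + 1))"
      using * L0 by (intro mult_left_mono) auto
    also have "\<dots> < e"
      using \<open>e > 0\<close> L0 by (simp add: field_simps)
    finally show "(\<Sum>i<n. dist (f (a i)) (f (b i))) < e" .
  qed
qed

lemma real_derivative_bound_imp_lipschitz: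
  fixes f :: "real \<Rightarrow> real"
  assumes "convex S" "0 \<le> C"
    and D: "\<And>t. t \<in> S \<Longrightarrow> (f has_real_derivative f' t) (at t within S)"
    and C: "\<And>t. t \<in> S \<Longrightarrow> \<bar>f' t\<bar> \<le> C"
  shows "C-lipschitz_on S f"
proof (rule bounded_derivative_imp_lipschitz)
  show "(f has_derivative (*) (f' t)) (at t within S)" if "t \<in> S" for t
    using D[OF that] by (simp add: has_field_derivative_def)
  show "onorm ((*) (f' t)) \<le> C" if "t \<in> S" for t
    by (rule onorm_le) (simp add: abs_mult mult_right_mono[OF C[OF that]])
qed (use assms in auto)

lemma integral_initial_segment_lipschitz:
  fixes h :: "real \<Rightarrow> real"
  assumes "continuous_on {0..1} h"
  shows "\<exists>L. L-lipschitz_on {0..1} (\<lambda>t. integral {0..t} h)"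
proof -
  have "bounded (h ` {0..1})"
    using assms by (intro compact_imp_bounded compact_continuous_image) auto
  then obtain C where C: "\<And>x. x \<in> {0..1} \<Longrightarrow> \<bar>h x\<bar> \<le> C"
    unfolding bounded_iff by fastforce
  have "C-lipschitz_on {0..1} (\<lambda>t. integral {0..t} h)"
  proof (rule real_derivative_bound_imp_lipschitz)
    show "((\<lambda>t. integral {0..t} h) has_real_derivative h t) (at t within {0..1})" if "t \<in> {0..1}" for t
      using assms that by (rule integral_has_real_derivative)
    show "0 \<le> C"
      using C[of 0] by auto
  qed (use C in auto)
  then show ?thesis ..
qed

text \<open>The minus signs anticipate a second coordinate \<open>g\<close> with derivative \<open>-1\<close> wherever
  \<open>f\<close> is nonzero. In that case the horizontality equations \<open>x3' = x1 * x2'\<close> and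
  \<open>x4' = x1^2 / 2 * x2'\<close> become \<open>x3' = - f\<close> and \<open>x4' = - f^2 / 2\<close>, whose right-hand sides are
  continuous although \<open>g'\<close> is not, so that these two coordinates are differentiable everywhere.\<close>

definition engel_curve :: "(real \<Rightarrow> real) \<Rightarrow> (real \<Rightarrow> real) \<Rightarrow> real \<Rightarrow> real^4" where
  "engel_curve f g t = f t *\<^sub>R axis 1 1 + g t *\<^sub>R axis 2 1
     - integral {0..t} f *\<^sub>R axis 3 1 - integral {0..t} (\<lambda>u. (f u)\<^sup>2 / 2) *\<^sub>R axis 4 1"

lemma engel_curve_nth [simp]:
  "engel_curve f g t $ 1 = f t" "engel_curve f g t $ 2 = g t"
  "engel_curve f g t $ 4 = - integral {0..t} (\<lambda>u. (f u)\<^sup>2 / 2)"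
  by (simp_all add: engel_curve_def axis_def)

lemma engel_curve_lipschitz:
  assumes "A-lipschitz_on {0..1} f" "B-lipschitz_on {0..1} g"
  shows "\<exists>L. L-lipschitz_on {0..1} (engel_curve f g)"
proof -
  have f: "continuous_on {0..1} f"
    using assms(1) by (rule lipschitz_on_continuous_on)
  obtain C where C: "C-lipschitz_on {0..1} (\<lambda>t. integral {0..t} f)"
    using integral_initial_segment_lipschitz[OF f] by blast
  have "continuous_on {0..1} (\<lambda>u. (f u)\<^sup>2 / 2)"
    using f by (auto intro!: continuous_intros)
  then obtain D where D: "D-lipschitz_on {0..1} (\<lambda>t. integral {0..t} (\<lambda>u. (f u)\<^sup>2 / 2))"
    using integral_initial_segment_lipschitz by blast
  have ax: "E-lipschitz_on {0..1} (\<lambda>t. h t *\<^sub>R axis i (1::real))"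
    if "E-lipschitz_on {0..1} h" for E and h :: "real \<Rightarrow> real" and i :: 4
    using that by (auto simp: lipschitz_on_def dist_norm scaleR_left_diff_distrib[symmetric])
  have "(A + B + C + D)-lipschitz_on {0..1} (engel_curve f g)"
    unfolding engel_curve_def[abs_def]
    by (rule lipschitz_on_diff lipschitz_on_add ax assms C D)+
  then show ?thesis ..
qed

text \<open>The condition \<open>f t * b = - f t\<close> says \<open>f t = 0\<close> or \<open>b = -1\<close>: the velocity \<open>b\<close> is unconstrained
  exactly where \<open>f\<close> vanishes. The last two coordinates are differentiable by the fundamental theorem of
  calculus.\<close>

lemma engel_curve_horizontal_velocity:
  assumes f: "(f has_real_derivative a) (at t within {0..1})" "continuous_on {0..1} f"
    and g: "(g has_real_derivative b) (at t within {0..1})"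
    and fb: "f t * b = - f t" and t: "t \<in> {0..1}"
  shows "(engel_curve f g has_vector_derivative
           a *\<^sub>R engel_X1 (engel_curve f g t) + b *\<^sub>R engel_X2 (engel_curve f g t)) (at t within {0..1})"
proof -
  have cont2: "continuous_on {0..1} (\<lambda>u. (f u)\<^sup>2 / 2)"
    using f(2) by (auto intro!: continuous_intros)
  have i: "((\<lambda>t. integral {0..t} h) has_real_derivative h t) (at t within {0..1})"
    if "continuous_on {0..1} h" for h
    by (rule integral_has_real_derivative[OF that t])
  have ax: "((\<lambda>t. h t *\<^sub>R axis k (1::real)) has_vector_derivative c *\<^sub>R axis k 1) (at t within {0..1})"
    if "(h has_real_derivative c) (at t within {0..1})" for h c and k :: 4
    using has_vector_derivative_scaleR[OF that has_vector_derivative_const[of "axis k (1::real)"]] by simp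
  have "(f t)\<^sup>2 / 2 * b = - ((f t)\<^sup>2 / 2)"
    using fb by (simp add: power2_eq_square mult.assoc)
  then have eq: "a *\<^sub>R engel_X1 (engel_curve f g t) + b *\<^sub>R engel_X2 (engel_curve f g t) =
      a *\<^sub>R axis 1 1 + b *\<^sub>R axis 2 1 - f t *\<^sub>R axis 3 1 - ((f t)\<^sup>2 / 2) *\<^sub>R axis 4 1"
    using fb by (simp add: engel_X1_def engel_X2_def scaleR_add_right mult.commute[of b])
  show ?thesis
    unfolding eq unfolding engel_curve_def[abs_def]
    by (intro has_vector_derivative_diff has_vector_derivative_add ax f(1) g i f(2) cont2)
qed

section \<open>Monotonicity of the fourth coordinate as an obstruction\<close>

lemma has_vector_derivative_vec_nth:
  "(f has_vector_derivative D) F \<Longrightarrow> ((\<lambda>t. f t $ i) has_vector_derivative D $ i) F"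
  by (rule bounded_linear.has_vector_derivative[OF bounded_linear_vec_nth])

text \<open>The one-sided constraint behind the whole argument: horizontality gives
  \<open>x4' = x1^2 / 2 * x2'\<close> almost everywhere, so \<open>x4\<close> cannot decrease while \<open>x2\<close> does not. Since the
  equation is integrated, the exceptional null set is harmless.\<close>

lemma horizontal_fourth_coordinate_mono:
  assumes hor: "engel_horizontal \<Gamma>"
    and D: "\<And>u. u \<in> {0..1} \<Longrightarrow> (\<Gamma> has_vector_derivative \<Gamma>' u) (at u within {0..1})"
    and st: "0 \<le> s" "s \<le> t" "t \<le> 1"
    and pos: "\<And>u. u \<in> {s..t} \<Longrightarrow> 0 \<le> \<Gamma>' u $ 2"
  shows "\<Gamma> s $ 4 \<le> \<Gamma> t $ 4"
proof -
  have sub: "{s..t} \<subseteq> {0..1}"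
    using st by auto
  have "((\<lambda>u. \<Gamma> u $ 4) has_vector_derivative \<Gamma>' u $ 4) (at u within {s..t})" if "u \<in> {s..t}" for u
    by (rule has_vector_derivative_vec_nth, rule has_vector_derivative_within_subset[OF D sub])
       (use that sub in auto)
  then have int: "((\<lambda>u. \<Gamma>' u $ 4) has_integral \<Gamma> t $ 4 - \<Gamma> s $ 4) {s..t}"
    using st by (intro fundamental_theorem_of_calculus) auto
  have "AE u in lebesgue. u \<in> {0..1} \<longrightarrow> (\<exists>a b. (\<Gamma> has_vector_derivative
           a *\<^sub>R engel_X1 (\<Gamma> u) + b *\<^sub>R engel_X2 (\<Gamma> u)) (at u within {0..1}))"
    using hor by (simp add: engel_horizontal_def AE_restrict_space_iff)
  then have "AE u in lebesgue. u \<in> {s..t} \<longrightarrow> \<Gamma>' u $ 4 = (\<Gamma> u $ 1)\<^sup>2 / 2 * \<Gamma>' u $ 2"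
  proof eventually_elim
    case (elim u)
    show ?case
    proof
      assume "u \<in> {s..t}"
      then have u: "u \<in> {0..1}"
        using sub by auto
      with elim obtain a b where ab: "(\<Gamma> has_vector_derivative
           a *\<^sub>R engel_X1 (\<Gamma> u) + b *\<^sub>R engel_X2 (\<Gamma> u)) (at u within {0..1})"
        by blast
      have "\<Gamma>' u = a *\<^sub>R engel_X1 (\<Gamma> u) + b *\<^sub>R engel_X2 (\<Gamma> u)"
        using vector_derivative_unique_within_closed_interval[of 0 1 u \<Gamma>] u D[OF u] ab by auto
      then show "\<Gamma>' u $ 4 = (\<Gamma> u $ 1)\<^sup>2 / 2 * \<Gamma>' u $ 2"
        by simp
    qed
  qed
  then obtain N where N: "N \<in> null_sets lebesgue"
      "\<And>u. u \<in> {s..t} - N \<Longrightarrow> \<Gamma>' u $ 4 = (\<Gamma> u $ 1)\<^sup>2 / 2 * \<Gamma>' u $ 2"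
    by (auto elim!: AE_E3)
  have "((\<lambda>u. (\<Gamma> u $ 1)\<^sup>2 / 2 * \<Gamma>' u $ 2) has_integral \<Gamma> t $ 4 - \<Gamma> s $ 4) {s..t}"
    by (rule has_integral_spike[OF _ _ int, of N]) (use N in \<open>auto simp: negligible_iff_null_sets\<close>)
  then have "0 \<le> \<Gamma> t $ 4 - \<Gamma> s $ 4"
    by (rule has_integral_nonneg) (use pos in auto)
  then show ?thesis by simp
qed

text \<open>At a limit point of the agreement set both curves have the same derivative along that set, so
  the second velocity of \<open>\<Gamma>\<close> there is that of \<open>\<gamma>\<close>. Continuity of \<open>\<Gamma>'\<close> then propagates its
  sign to a neighbourhood; for a merely Lipschitz curve such as \<open>\<gamma>\<close> this step would fail.\<close>

lemma positive_second_velocity_near_limit_point: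
  fixes \<gamma> \<Gamma> :: "real \<Rightarrow> real^4"
  assumes D: "\<And>u. u \<in> {0..1} \<Longrightarrow> (\<Gamma> has_vector_derivative \<Gamma>' u) (at u within {0..1})"
    and cont: "continuous_on {0..1} \<Gamma>'"
    and B: "B \<subseteq> {0..1}" "\<And>u. u \<in> B \<Longrightarrow> \<gamma> u = \<Gamma> u" and t: "t \<in> B" "t islimpt B"
    and D2: "((\<lambda>u. \<gamma> u $ 2) has_real_derivative v) (at t within {0..1})" and "0 < v"
  obtains d where "0 < d" "\<And>u. u \<in> {0..1} \<Longrightarrow> dist u t < d \<Longrightarrow> 0 < \<Gamma>' u $ 2"
proof -
  have t01: "t \<in> {0..1}"
    using B t by auto
  have 1: "((\<lambda>u. \<Gamma> u $ 2) has_vector_derivative \<Gamma>' t $ 2) (at t within B)"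
    by (intro has_vector_derivative_vec_nth has_vector_derivative_within_subset[OF D[OF t01] B(1)])
  have "((\<lambda>u. \<gamma> u $ 2) has_vector_derivative v) (at t within B)"
    using D2 by (auto simp: has_real_derivative_iff_has_vector_derivative
        intro: has_vector_derivative_within_subset[OF _ B(1)])
  then have 2: "((\<lambda>u. \<Gamma> u $ 2) has_vector_derivative v) (at t within B)"
    by (rule has_vector_derivative_transform[OF t(1), rotated]) (use B in auto)
  have "\<Gamma>' t $ 2 = v"
    by (rule vector_derivative_unique_within[OF _ 1 2]) (use t(2) in \<open>simp add: trivial_limit_within\<close>)
  moreover have "continuous_on {0..1} (\<lambda>u. \<Gamma>' u $ 2)"
    by (intro continuous_intros cont)
  ultimately have "\<exists>d>0. \<forall>u\<in>{0..1}. dist u t < d \<longrightarrow> dist (\<Gamma>' u $ 2) v < v"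
    using t01 \<open>0 < v\<close> unfolding continuous_on_iff by metis
  then obtain d where d: "d > 0" "\<And>u. u \<in> {0..1} \<Longrightarrow> dist u t < d \<Longrightarrow> dist (\<Gamma>' u $ 2) v < v"
    by blast
  show ?thesis
  proof (rule that[OF d(1)])
    show "0 < \<Gamma>' u $ 2" if "u \<in> {0..1}" "dist u t < d" for u
      using d(2)[OF that] by (simp add: dist_real_def abs_if split: if_splits)
  qed
qed

text \<open>A discrete subspace of a second countable space injects into a countable basis: each of its
  points is cut out by a basic open set.\<close>

lemma countable_if_no_islimpt_in_itself:
  fixes B :: "'a::{second_countable_topology, t1_space} set"
  assumes iso: "\<And>x. x \<in> B \<Longrightarrow> \<not> x islimpt B"
  shows "countable B"
proof -
  obtain \<B> :: "'a set set" where \<B>: "countable \<B>" "topological_basis \<B>"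
    using ex_countable_basis by auto
  have "\<exists>V\<in>\<B>. V \<inter> B = {x}" if x: "x \<in> B" for x
  proof -
    obtain T where T: "x \<in> T" "open T" "\<And>y. y \<in> B \<Longrightarrow> y \<in> T \<Longrightarrow> y = x"
      using iso[OF x] by (auto simp: islimpt_def)
    obtain V where "V \<in> \<B>" "x \<in> V" "V \<subseteq> T"
      using topological_basisE[OF \<B>(2) T(2,1)] by metis
    moreover from this have "V \<inter> B = {x}"
      using T(3) x by blast
    ultimately show ?thesis
      by blast
  qed
  then obtain V where V: "\<And>x. x \<in> B \<Longrightarrow> V x \<in> \<B> \<and> V x \<inter> B = {x}"
    by metis
  have "inj_on V B"
  proof (rule inj_onI)
    fix x y assume "x \<in> B" "y \<in> B" "V x = V y"
    then have "{x} = {y}"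
      using V by metis
    then show "x = y" by simp
  qed
  moreover have "countable (V ` B)"
    by (rule countable_subset[OF _ \<B>(1)]) (use V in auto)
  ultimately show ?thesis
    by (rule countable_image_inj_on[rotated])
qed

lemma integral_square_strict_mono:
  fixes f :: "real \<Rightarrow> real"
  assumes f: "continuous_on {0..1} f" and st: "0 \<le> s" "s < t" "t \<le> 1"
    and u: "s < u" "u < t" "f u \<noteq> 0"
  shows "integral {0..s} (\<lambda>u. (f u)\<^sup>2 / 2) < integral {0..t} (\<lambda>u. (f u)\<^sup>2 / 2)"
proof -
  let ?h = "\<lambda>u. (f u)\<^sup>2 / 2"
  have c: "continuous_on {0..1} ?h"
    using f by (auto intro!: continuous_intros)
  have cst: "continuous_on {s..t} ?h"
    by (rule continuous_on_subset[OF c]) (use st in auto)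
  have "integral {0..s} ?h + integral {s..t} ?h = integral {0..t} ?h"
    using st by (intro Henstock_Kurzweil_Integration.integral_combine integrable_continuous_real
        continuous_on_subset[OF c]) auto
  moreover have "0 \<le> integral {s..t} ?h"
    by (intro Henstock_Kurzweil_Integration.integral_nonneg integrable_continuous_real cst) auto
  moreover have "integral {s..t} ?h \<noteq> 0"
    using integral_eq_0_iff[OF cst st(2)] u by force
  ultimately show ?thesis
    by linarith
qed

text \<open>If \<open>B\<close> had a limit point in itself, then near it \<open>\<Gamma>\<close> would move forward in the second
  coordinate, and hence not decrease in the fourth. But between any two points of \<open>B\<close> the fourth
  coordinate of the curve drops strictly, because the zeros of \<open>f\<close> contain no interval. So all points
  of \<open>B\<close> are isolated.\<close>

lemma countable_agreement_at_unit_second_velocity: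
  assumes f: "continuous_on {0..1} f"
    and dense: "\<And>s t. 0 \<le> s \<Longrightarrow> s < t \<Longrightarrow> t \<le> 1 \<Longrightarrow> \<exists>u. s < u \<and> u < t \<and> f u \<noteq> 0"
    and \<Gamma>: "C1_curve \<Gamma>" "engel_horizontal \<Gamma>"
    and B: "B \<subseteq> {0..1}" "\<And>t. t \<in> B \<Longrightarrow> engel_curve f g t = \<Gamma> t"
    and g: "\<And>t. t \<in> B \<Longrightarrow> (g has_real_derivative 1) (at t within {0..1})"
  shows "countable B"
proof (rule countable_if_no_islimpt_in_itself)
  fix t assume t: "t \<in> B"
  obtain \<Gamma>' where D: "\<And>u. u \<in> {0..1} \<Longrightarrow> (\<Gamma> has_vector_derivative \<Gamma>' u) (at u within {0..1})"
    and cont: "continuous_on {0..1} \<Gamma>'"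
    using \<Gamma>(1) unfolding C1_curve_def by blast
  show "\<not> t islimpt B"
  proof
    assume lim: "t islimpt B"
    have g2: "((\<lambda>u. engel_curve f g u $ 2) has_real_derivative 1) (at t within {0..1})"
      using g[OF t] by simp
    obtain d where d: "0 < d" "\<And>u. u \<in> {0..1} \<Longrightarrow> dist u t < d \<Longrightarrow> 0 < \<Gamma>' u $ 2"
      using positive_second_velocity_near_limit_point[OF D cont B t lim g2] by auto
    obtain t' where t': "t' \<in> B" "t' \<noteq> t" "dist t' t < d"
      using lim d(1) unfolding islimpt_approachable by blast
    define x y where "x = min t t'" and "y = max t t'"
    have xy: "x \<in> B" "y \<in> B" "x < y" "0 \<le> x" "y \<le> 1"
      using t t' B(1) by (auto simp: x_def y_def min_def max_def)
    have "\<Gamma> x $ 4 \<le> \<Gamma> y $ 4"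
    proof (rule horizontal_fourth_coordinate_mono[OF \<Gamma>(2) D])
      fix u assume "u \<in> {x..y}"
      then have "u \<in> {0..1}" "dist u t < d"
        using xy t'(3) by (auto simp: x_def y_def dist_real_def min_def max_def split: if_splits)
      then show "0 \<le> \<Gamma>' u $ 2"
        using d(2) by (simp add: less_imp_le)
    qed (use xy in auto)
    moreover have "\<Gamma> y $ 4 < \<Gamma> x $ 4"
    proof -
      obtain u where "x < u" "u < y" "f u \<noteq> 0"
        using dense xy by blast
      then show ?thesis
        using integral_square_strict_mono[OF f, of x y u] xy B(2)[of x, symmetric] B(2)[of y, symmetric]
        by simp
    qed
    ultimately show False by simp
  qed
qed

section \<open>A differentiable function with prescribed zero set\<close>

text \<open>Squaring the positive part is the cheapest way to make it differentiable at the corner; the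
  bumps below are built from it.\<close>

lemma has_real_derivative_max0_power2:
  "((\<lambda>u. (max 0 u)\<^sup>2) has_real_derivative 2 * max 0 u) (at (u::real))"
proof (cases u "0::real" rule: linorder_cases)
  case less
  have "((\<lambda>u. 0) has_real_derivative 0) (at u)"
    by simp
  then have "((\<lambda>u. (max 0 u)\<^sup>2) has_real_derivative 0) (at u)"
    by (rule has_field_derivative_transform_within_open[where S = "{..<0}"])
       (use less in \<open>auto simp: max_def\<close>)
  with less show ?thesis by simp
next
  case greater
  have "((\<lambda>u. u\<^sup>2) has_real_derivative 2 * u) (at u)"
    by (auto intro!: derivative_eq_intros)
  then have "((\<lambda>u. (max 0 u)\<^sup>2) has_real_derivative 2 * u) (at u)"
    by (rule has_field_derivative_transform_within_open[where S = "{0<..}"])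
       (use greater in \<open>auto simp: max_def\<close>)
  with greater show ?thesis by simp
next
  case equal
  have "((\<lambda>h. (max 0 h)\<^sup>2 / h) \<longlongrightarrow> 0) (at (0::real))"
  proof (rule Lim_null_comparison)
    show "\<forall>\<^sub>F h in at 0. norm ((max 0 h)\<^sup>2 / h) \<le> \<bar>h::real\<bar>"
      by (intro always_eventually allI) (auto simp: max_def power2_eq_square)
    show "((\<lambda>h. \<bar>h\<bar>) \<longlongrightarrow> 0) (at (0::real))"
      by (intro tendsto_rabs_zero tendsto_ident_at)
  qed
  then show ?thesis
    using equal by (simp add: has_field_derivative_iff)
qed

lemma bump_derivative:
  fixes q r t :: real
  shows "((\<lambda>t. (max 0 (r\<^sup>2 - (t - q)\<^sup>2))\<^sup>2) has_real_derivative
           - 4 * (t - q) * max 0 (r\<^sup>2 - (t - q)\<^sup>2)) (at t)"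
proof -
  have 1: "((\<lambda>t. r\<^sup>2 - (t - q)\<^sup>2) has_real_derivative - 2 * (t - q)) (at t)"
    by (auto intro!: derivative_eq_intros)
  show ?thesis
    using DERIV_chain2[OF has_real_derivative_max0_power2 1]
    by (rule DERIV_cong) (simp add: algebra_simps)
qed

lemma bump_derivative_bound:
  fixes q r t :: real
  assumes "0 \<le> r"
  shows "\<bar>- 4 * (t - q) * max 0 (r\<^sup>2 - (t - q)\<^sup>2)\<bar> \<le> 4 * r ^ 3"
proof (cases "\<bar>t - q\<bar> \<le> r")
  case True
  have "\<bar>t - q\<bar> * max 0 (r\<^sup>2 - (t - q)\<^sup>2) \<le> r * r\<^sup>2"
    using True assms by (intro mult_mono) auto
  moreover have "\<bar>- 4 * (t - q) * max 0 (r\<^sup>2 - (t - q)\<^sup>2)\<bar>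
      = 4 * (\<bar>t - q\<bar> * max 0 (r\<^sup>2 - (t - q)\<^sup>2))"
    by (simp only: abs_mult)
  moreover have "r * r\<^sup>2 = r ^ 3"
    by (simp add: power2_eq_square power3_eq_cube)
  ultimately show ?thesis
    by linarith
next
  case False
  then have "r\<^sup>2 \<le> (t - q)\<^sup>2"
    using power_mono[of r "\<bar>t - q\<bar>" 2] assms by simp
  then have "max 0 (r\<^sup>2 - (t - q)\<^sup>2) = 0"
    by (intro max_absorb1) linarith
  with assms show ?thesis
    by simp
qed

text \<open>Sum one bump per ball. All bumps are nonnegative, so overlaps of the balls do no harm and the
  connected components of the union are never needed. The bump on a ball of radius \<open>r n\<close> has
  derivative of order \<open>r n ^ 3\<close>, so the differentiated series converges uniformly without any further
  scaling of the summands.\<close>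

lemma differentiable_function_positive_exactly_on_union_of_balls:
  fixes q r :: "nat \<Rightarrow> real"
  assumes r0: "\<And>n. 0 < r n" and r1: "\<And>n. r n \<le> 1" and sr: "summable r"
  shows "\<exists>f f' :: real \<Rightarrow> real. \<exists>L.
    (\<forall>t. (f has_real_derivative f' t) (at t)) \<and> (\<forall>t. \<bar>f' t\<bar> \<le> L) \<and>
    (\<forall>t \<in> (\<Union>n. ball (q n) (r n)). 0 < f t) \<and> (\<forall>t. t \<notin> (\<Union>n. ball (q n) (r n)) \<longrightarrow> f t = 0)"
proof -
  define \<psi> where "\<psi> n t = (max 0 ((r n)\<^sup>2 - (t - q n)\<^sup>2))\<^sup>2" for n t
  define \<psi>' where "\<psi>' n t = - 4 * (t - q n) * max 0 ((r n)\<^sup>2 - (t - q n)\<^sup>2)" for n t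
  have d: "(\<psi> n has_real_derivative \<psi>' n t) (at t)" for n t
    unfolding \<psi>_def \<psi>'_def by (rule bump_derivative)
  have p: "r n ^ k \<le> r n" if "k \<ge> 1" for n k
    using power_decreasing[of 1 k "r n"] that r0[of n] r1[of n] by simp
  have b': "\<bar>\<psi>' n t\<bar> \<le> 4 * r n" for n t
    using bump_derivative_bound[of "r n" t "q n"] p[of 3 n] r0[of n] unfolding \<psi>'_def by simp
  have b: "\<bar>\<psi> n t\<bar> \<le> r n" for n t
  proof -
    have "(max 0 ((r n)\<^sup>2 - (t - q n)\<^sup>2))\<^sup>2 \<le> ((r n)\<^sup>2)\<^sup>2"
      by (intro power_mono) auto
    then show ?thesis
      using p[of 4 n] by (simp add: \<psi>_def power_mult[symmetric])
  qed
  have s4: "summable (\<lambda>n. 4 * r n)"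
    using sr by (rule summable_mult)
  have sum: "summable (\<lambda>n. \<psi> n t)" for t
    by (rule summable_comparison_test'[OF sr, of 0]) (use b in auto)
  have sum': "summable (\<lambda>n. \<bar>\<psi>' n t\<bar>)" for t
    by (rule summable_comparison_test'[OF s4, of 0]) (use b' in auto)
  have "uniform_limit UNIV (\<lambda>n t. \<Sum>i<n. \<psi>' i t) (\<lambda>t. suminf (\<lambda>i. \<psi>' i t)) sequentially"
    by (rule Weierstrass_m_test[OF _ s4]) (use b' in auto)
  then have uc: "uniformly_convergent_on UNIV (\<lambda>n t. \<Sum>i<n. \<psi>' i t)"
    by (auto simp: uniformly_convergent_on_def)
  have D: "((\<lambda>t. \<Sum>n. \<psi> n t) has_real_derivative (\<Sum>n. \<psi>' n t)) (at t)" for t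
    by (rule has_field_derivative_series'(2)[of UNIV \<psi> \<psi>' 0])
       (use d uc sum in \<open>auto\<close>)
  have \<psi>_pos: "0 < \<psi> n t \<longleftrightarrow> t \<in> ball (q n) (r n)" for n t
  proof -
    have "0 < \<psi> n t \<longleftrightarrow> (t - q n)\<^sup>2 < (r n)\<^sup>2"
      by (auto simp: \<psi>_def max_def)
    also have "\<dots> \<longleftrightarrow> \<bar>t - q n\<bar> < r n"
      using r0[of n] by (metis abs_le_square_iff abs_of_pos linorder_not_le)
    finally show ?thesis
      by (auto simp: dist_real_def)
  qed
  have \<psi>_nonneg: "0 \<le> \<psi> n t" for n t
    by (simp add: \<psi>_def)
  have bound: "\<bar>\<Sum>n. \<psi>' n t\<bar> \<le> (\<Sum>n. 4 * r n)" for t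
    using summable_rabs[OF sum'[of t]] suminf_le[OF b' sum'[of t] s4] by simp
  have inside: "0 < (\<Sum>n. \<psi> n t)" if "t \<in> (\<Union>n. ball (q n) (r n))" for t
    using that suminf_pos2[OF sum[of t] \<psi>_nonneg] \<psi>_pos by auto
  have outside: "(\<Sum>n. \<psi> n t) = 0" if "t \<notin> (\<Union>n. ball (q n) (r n))" for t
  proof -
    have "\<psi> n t = 0" for n
      using that \<psi>_pos[of n t] \<psi>_nonneg[of n t] by fastforce
    then show ?thesis by simp
  qed
  show ?thesis
    by (rule exI[of _ "\<lambda>t. \<Sum>n. \<psi> n t"], rule exI[of _ "\<lambda>t. \<Sum>n. \<psi>' n t"],
        rule exI[of _ "\<Sum>n. 4 * r n"]) (intro conjI allI ballI impI D bound inside outside; assumption)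
qed

section \<open>Measure of an open set in initial segments\<close>

text \<open>Countable subadditivity, where only the balls that meet \<open>S\<close> have to be paid for.\<close>

lemma measure_union_balls_le:
  fixes q r :: "nat \<Rightarrow> real"
  assumes "S \<in> sets lebesgue" and S: "S \<subseteq> (\<Union>n. ball (q n) (r n))"
    and r0: "\<And>n. 0 \<le> r n" 
    and B: "\<And>n. ball (q n) (r n) \<inter> S \<noteq> {} \<Longrightarrow> 2 * r n \<le> B n" 
    and B0: "\<And>n. 0 \<le> B n" and sB: "summable B"
  shows "S \<in> lmeasurable" "measure lebesgue S \<le> (\<Sum>n. B n)"
proof -
  define T where "T n = (if ball (q n) (r n) \<inter> S = {} then {} else ball (q n) (r n))" for n
  have T: "T n \<in> lmeasurable" "measure lebesgue (T n) \<le> B n" for n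
    using B[of n] B0[of n] r0[of n] by (auto simp: T_def ball_eq_greaterThanLessThan)
  have ST: "S \<subseteq> (\<Union>n. T n)"
  proof
    fix x assume "x \<in> S"
    then obtain n where "x \<in> ball (q n) (r n)"
      using S by blast
    then have "x \<in> T n"
      using \<open>x \<in> S\<close> by (auto simp: T_def)
    then show "x \<in> (\<Union>n. T n)"
      by blast
  qed
  have fin: "measure lebesgue (\<Union>k\<le>n. T k) \<le> (\<Sum>n. B n)" for n
  proof -
    have "measure lebesgue (\<Union>k\<le>n. T k) \<le> (\<Sum>k\<le>n. measure lebesgue (T k))"
      by (rule measure_UNION_le) (use T in auto)
    also have "\<dots> \<le> (\<Sum>k\<le>n. B k)"
      by (intro sum_mono T)
    also have "\<dots> \<le> (\<Sum>n. B n)"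
      by (rule sum_le_suminf[OF sB]) (use B0 in auto)
    finally show ?thesis .
  qed
  note U = fmeasurable_countable_Union[of T lebesgue "\<Sum>n. B n", OF T(1) fin]
    measure_countable_Union_le[of T lebesgue "\<Sum>n. B n", OF T(1) fin]
  show "S \<in> lmeasurable"
    by (rule fmeasurableI2[OF U(1) ST]) (rule assms)
  show "measure lebesgue S \<le> (\<Sum>n. B n)"
    using measure_mono_fmeasurable[OF ST assms(1) U(1)] U(2) by simp
qed

text \<open>A quantitative substitute for the Lebesgue density theorem. By Borel-Cantelli almost every \<open>t\<close>
  stays outside all but finitely many of the balls of radius \<open>2 * \<rho> n\<close>. For such \<open>n\<close> the distance of
  \<open>t\<close> to the much smaller ball of radius \<open>\<rho> n ^ 3\<close> is at least \<open>\<rho> n\<close>, and the quotient is at most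
  \<open>\<rho> n\<close>. The finitely many other indices do not affect summability, and discarding the countably many
  boundary points of the small balls makes all distances strictly positive.\<close>

lemma AE_summable_cube_over_square_distance:
  fixes q \<rho> :: "nat \<Rightarrow> real"
  assumes \<rho>0: "\<And>n. 0 < \<rho> n" and \<rho>1: "\<And>n. \<rho> n \<le> 1" and s\<rho>: "summable \<rho>"
  shows "AE t in lebesgue. t \<notin> (\<Union>n. ball (q n) (\<rho> n ^ 3)) \<longrightarrow>
           (\<forall>n. \<rho> n ^ 3 < \<bar>t - q n\<bar>) \<and> summable (\<lambda>n. \<rho> n ^ 3 / (\<bar>t - q n\<bar> - \<rho> n ^ 3)\<^sup>2)"
proof -
  have "AE t in lebesgue. eventually (\<lambda>n. t \<in> space lebesgue - cball (q n) (2 * \<rho> n)) sequentially"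
  proof (rule borel_cantelli_AE1)
    have "measure lebesgue (cball (q n) (2 * \<rho> n)) = 4 * \<rho> n" for n
      using \<rho>0[of n] by (simp add: cball_eq_atLeastAtMost)
    then show "summable (\<lambda>n. measure lebesgue (cball (q n) (2 * \<rho> n)))"
      using s\<rho> by (simp add: summable_mult)
    show "emeasure lebesgue (cball (q n) (2 * \<rho> n)) < \<infinity>" for n
      using emeasure_bounded_finite[of "cball (q n) (2 * \<rho> n)"] by simp
  qed auto
  moreover have "AE t in lebesgue. \<forall>n. \<bar>t - q n\<bar> \<noteq> \<rho> n ^ 3"
  proof -
    have "countable (\<Union>n. {q n + \<rho> n ^ 3, q n - \<rho> n ^ 3})"
      by simp
    then have "(\<Union>n. {q n + \<rho> n ^ 3, q n - \<rho> n ^ 3}) \<in> null_sets lebesgue"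
      by (intro null_sets_completionI countable_imp_null_set_lborel)
    then have "AE t in lebesgue. t \<notin> (\<Union>n. {q n + \<rho> n ^ 3, q n - \<rho> n ^ 3})"
      by (rule AE_not_in)
    then show ?thesis
    proof eventually_elim
      case (elim t)
      then have "t \<noteq> q n + \<rho> n ^ 3" "t \<noteq> q n - \<rho> n ^ 3" for n
        by auto
      then show ?case
        by (metis abs_eq_iff' add_diff_eq diff_add_cancel add_uminus_conv_diff add.commute)
    qed
  qed
  ultimately show ?thesis
  proof eventually_elim
    case (elim t)
    show ?case
    proof (intro impI conjI)
      assume out: "t \<notin> (\<Union>n. ball (q n) (\<rho> n ^ 3))"
      show "\<forall>n. \<rho> n ^ 3 < \<bar>t - q n\<bar>"
      proof
        fix n
        have "\<not> \<bar>t - q n\<bar> < \<rho> n ^ 3"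
          using out by (auto simp: dist_real_def abs_minus_commute)
        with elim(2) show "\<rho> n ^ 3 < \<bar>t - q n\<bar>"
          by (meson linorder_neqE_linordered_idom)
      qed
      have "\<forall>\<^sub>F n in sequentially. norm (\<rho> n ^ 3 / (\<bar>t - q n\<bar> - \<rho> n ^ 3)\<^sup>2) \<le> \<rho> n"
        using elim(1)
      proof eventually_elim
        case (elim n)
        have cube: "\<rho> n ^ 3 \<le> \<rho> n"
          using power_decreasing[of 1 3 "\<rho> n"] \<rho>0[of n] \<rho>1[of n] by simp
        have far: "\<rho> n \<le> \<bar>t - q n\<bar> - \<rho> n ^ 3"
          using elim cube by (simp add: dist_real_def abs_minus_commute)
        have "\<rho> n ^ 3 / (\<bar>t - q n\<bar> - \<rho> n ^ 3)\<^sup>2 \<le> \<rho> n ^ 3 / (\<rho> n)\<^sup>2"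
          using \<rho>0[of n] far by (intro divide_left_mono power_mono mult_pos_pos) auto
        also have "\<dots> = \<rho> n"
          using \<rho>0[of n] by (simp add: power2_eq_square power3_eq_cube)
        finally show ?case
          using \<rho>0[of n] by simp
      qed
      then show "summable (\<lambda>n. \<rho> n ^ 3 / (\<bar>t - q n\<bar> - \<rho> n ^ 3)\<^sup>2)"
        by (rule summable_comparison_test_ev[OF _ s\<rho>])
    qed
  qed
qed

lemma abs_measure_initial_segment_diff:
  fixes U :: "real set"
  assumes U: "U \<in> sets lebesgue" and "0 \<le> s" "0 \<le> t"
  shows "\<bar>measure lebesgue (U \<inter> {0..s}) - measure lebesgue (U \<inter> {0..t})\<bar>
           = measure lebesgue (U \<inter> {min s t<..max s t})"
proof -
  have m: "U \<inter> {a..b} \<in> lmeasurable" "U \<inter> {a<..b} \<in> lmeasurable" for a b :: real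
    by (rule fmeasurableI2[of "{a..b}"]; use U in auto)+
  have *: "measure lebesgue (U \<inter> {0..b}) =
      measure lebesgue (U \<inter> {0..a}) + measure lebesgue (U \<inter> {a<..b})" if "0 \<le> a" "a \<le> b" for a b :: real
  proof -
    have "U \<inter> {0..b} = (U \<inter> {0..a}) \<union> (U \<inter> {a<..b})"
      using that by auto
    moreover have "U \<inter> {a<..b} - U \<inter> {0..a} = U \<inter> {a<..b}"
      by auto
    ultimately show ?thesis
      using measure_Un2[OF m(1)[of 0 a] m(2)[of a b]] by simp
  qed
  show ?thesis
    using *[of s t] *[of t s] assms by (cases "s \<le> t") (auto simp: min_def max_def)
qed

lemma measure_initial_segment_lipschitz:
  fixes U :: "real set"
  assumes U: "U \<in> sets lebesgue"
  shows "1-lipschitz_on {0..1} (\<lambda>s. measure lebesgue (U \<inter> {0..s}))"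
proof (rule lipschitz_onI)
  fix s t :: real assume st: "s \<in> {0..1}" "t \<in> {0..1}"
  have "measure lebesgue (U \<inter> {min s t<..max s t}) \<le> measure lebesgue {min s t..max s t}"
    by (rule measure_mono_fmeasurable) (use U in auto)
  then show "dist (measure lebesgue (U \<inter> {0..s})) (measure lebesgue (U \<inter> {0..t})) \<le> 1 * dist s t"
    using abs_measure_initial_segment_diff[OF U, of s t] st
    by (auto simp: dist_real_def min_def max_def split: if_splits)
qed simp

lemma measure_initial_segment_derivative_inside:
  fixes U :: "real set"
  assumes "open U" "t \<in> U" "t \<in> {0..1}"
  shows "((\<lambda>s. measure lebesgue (U \<inter> {0..s})) has_real_derivative 1) (at t within {0..1})"
proof -
  have U: "U \<in> sets lebesgue"
    using assms(1) by (simp add: borel_open)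
  obtain d where d: "d > 0" "ball t d \<subseteq> U"
    using assms(1,2) openE by blast
  let ?m = "\<lambda>s. measure lebesgue (U \<inter> {0..s})"
  have eq: "?m t + (s - t) = ?m s" if s: "s \<in> {0..1}" "dist s t < d" for s
  proof -
    have sub: "{min s t<..max s t} \<subseteq> U"
      using d(2) s(2) by (force simp: dist_real_def min_def max_def split: if_splits)
    have "\<bar>?m s - ?m t\<bar> = \<bar>s - t\<bar>"
      using abs_measure_initial_segment_diff[OF U, of s t] sub s assms(3)
      by (simp add: Int_absorb1 min_def max_def)
    moreover have "?m a \<le> ?m b" if "a \<le> b" for a b
      by (rule measure_mono_fmeasurable)
         (use that U in \<open>auto intro!: fmeasurableI2[of "{0..b}" lebesgue "U \<inter> {0..b}"]\<close>)
    then have "s \<le> t \<Longrightarrow> ?m s \<le> ?m t" "t \<le> s \<Longrightarrow> ?m t \<le> ?m s"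
      by auto
    ultimately show ?thesis
      by (cases "s \<le> t") auto
  qed
  have "((\<lambda>s. ?m t + (s - t)) has_real_derivative 1) (at t within {0..1})"
    by (auto intro!: derivative_eq_intros)
  then show ?thesis
    by (rule has_field_derivative_transform_within[OF _ d(1) assms(3)]) (rule eq)
qed

lemma quadratic_contact_imp_derivative_zero:
  fixes g :: "real \<Rightarrow> real"
  assumes "\<And>s. s \<in> S \<Longrightarrow> \<bar>g s - g t\<bar> \<le> C * (s - t)\<^sup>2"
  shows "(g has_real_derivative 0) (at t within S)"
  unfolding has_field_derivative_iff
proof (rule Lim_null_comparison)
  have "norm ((g s - g t) / (s - t)) \<le> C * \<bar>s - t\<bar>" if "s \<in> S" "s \<noteq> t" for s
  proof -
    have "(s - t)\<^sup>2 = \<bar>s - t\<bar> * \<bar>s - t\<bar>"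
      by (simp add: power2_eq_square)
    then show ?thesis
      using assms[OF that(1)] that(2) by (simp add: abs_divide divide_le_eq mult.assoc)
  qed
  then show "\<forall>\<^sub>F s in at t within S. norm ((g s - g t) / (s - t)) \<le> C * \<bar>s - t\<bar>"
    by (auto simp: eventually_at_filter)
  have "((\<lambda>s. C * \<bar>s - t\<bar>) \<longlongrightarrow> C * \<bar>t - t\<bar>) (at t within S)"
    by (intro tendsto_intros)
  then show "((\<lambda>s. C * \<bar>s - t\<bar>) \<longlongrightarrow> 0) (at t within S)"
    by simp
qed

text \<open>A segment from \<open>t\<close> to \<open>s\<close> meets the ball of index \<open>n\<close> only if \<open>\<bar>s - t\<bar>\<close> is at least the
  distance \<open>\<bar>t - q n\<bar> - r n\<close> of \<open>t\<close> to it. The length \<open>2 * r n\<close> of the ball may therefore be multiplied by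
  the square of the quotient of these two numbers, and summation bounds the measure picked up between
  \<open>t\<close> and \<open>s\<close> by a multiple of \<open>(s - t)\<^sup>2\<close>.\<close>

lemma measure_initial_segment_derivative_outside:
  fixes q r :: "nat \<Rightarrow> real"
  assumes r0: "\<And>n. 0 < r n" and out: "\<And>n. r n < \<bar>t - q n\<bar>"
    and sm: "summable (\<lambda>n. r n / (\<bar>t - q n\<bar> - r n)\<^sup>2)" and t: "t \<in> {0..1}"
  shows "((\<lambda>s. measure lebesgue ((\<Union>n. ball (q n) (r n)) \<inter> {0..s})) has_real_derivative 0)
           (at t within {0..1})"
proof (rule quadratic_contact_imp_derivative_zero)
  fix s :: real assume s: "s \<in> {0..1}"
  define U where "U = (\<Union>n. ball (q n) (r n))"
  define B where "B n = 2 * (r n / (\<bar>t - q n\<bar> - r n)\<^sup>2) * (s - t)\<^sup>2" for n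
  have U: "U \<in> sets lebesgue"
    unfolding U_def by (intro sets.countable_UN) auto
  let ?S = "U \<inter> {min s t<..max s t}"
  have "measure lebesgue ?S \<le> (\<Sum>n. B n)"
  proof (rule measure_union_balls_le(2))
    show "?S \<in> sets lebesgue"
      using U by (rule sets.Int) simp
    show "?S \<subseteq> (\<Union>n. ball (q n) (r n))"
      by (auto simp: U_def)
    show "0 \<le> r n" "0 \<le> B n" for n
      using r0[of n] by (auto simp: B_def)
    show "summable B"
      unfolding B_def by (intro summable_mult summable_mult2 sm)
    show "2 * r n \<le> B n" if ne: "ball (q n) (r n) \<inter> ?S \<noteq> {}" for n
    proof -
      obtain y where "\<bar>y - q n\<bar> < r n" "min s t < y" "y \<le> max s t"
        using ne by (auto simp: dist_real_def abs_minus_commute)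
      \<comment> \<open>The ball reaches from \<open>q n\<close> to a point between \<open>s\<close> and \<open>t\<close>, so its gap to \<open>t\<close> is at most \<open>\<bar>s - t\<bar>\<close>.\<close>
      then have close: "\<bar>t - q n\<bar> - r n \<le> \<bar>s - t\<bar>"
        by (auto simp: min_def max_def split: if_splits)
      have pos: "0 < \<bar>t - q n\<bar> - r n"
        using out[of n] by simp
      have "(\<bar>t - q n\<bar> - r n)\<^sup>2 \<le> \<bar>s - t\<bar>\<^sup>2"
        using close pos by (intro power_mono) auto
      then have "1 \<le> (s - t)\<^sup>2 / (\<bar>t - q n\<bar> - r n)\<^sup>2"
        using pos by (subst le_divide_eq_1_pos) (auto intro: zero_less_power)
      then have "2 * r n * 1 \<le> 2 * r n * ((s - t)\<^sup>2 / (\<bar>t - q n\<bar> - r n)\<^sup>2)"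
        using r0[of n] by (intro mult_left_mono) auto
      then show ?thesis
        by (simp add: B_def)
    qed
  qed
  also have "\<dots> = (\<Sum>n. 2 * (r n / (\<bar>t - q n\<bar> - r n)\<^sup>2)) * (s - t)\<^sup>2"
    unfolding B_def by (rule suminf_mult2[symmetric]) (intro summable_mult sm)
  finally show "\<bar>measure lebesgue ((\<Union>n. ball (q n) (r n)) \<inter> {0..s}) -
       measure lebesgue ((\<Union>n. ball (q n) (r n)) \<inter> {0..t})\<bar>
       \<le> (\<Sum>n. 2 * (r n / (\<bar>t - q n\<bar> - r n)\<^sup>2)) * (s - t)\<^sup>2"
    using abs_measure_initial_segment_diff[OF U, of s t] s t by (simp add: U_def)
qed

section \<open>A Lipschitz curve meeting every C1 horizontal curve rarely\<close>

lemma ex_dense_sequence: "\<exists>q :: nat \<Rightarrow> real. \<forall>a b. a < b \<longrightarrow> (\<exists>n. a < q n \<and> q n < b)"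
proof (rule exI, intro allI impI)
  fix a b :: real assume "a < b"
  then obtain x where "x \<in> (\<rat> :: real set)" "a < x" "x < b"
    using Rats_dense_in_real by blast
  then show "\<exists>n. a < from_nat_into (\<rat> :: real set) n \<and> from_nat_into \<rat> n < b"
    by (metis countable_rat from_nat_into_surj)
qed

theorem theorem3p2:
  fixes \<epsilon> :: real
  assumes "\<epsilon> > 0"
  shows "\<exists>\<gamma> :: real \<Rightarrow> real^4.
           (\<exists>L. L-lipschitz_on {0..1} \<gamma>) \<and> engel_horizontal \<gamma> \<and>
           (\<forall>\<Gamma> :: real \<Rightarrow> real^4. C1_curve \<Gamma> \<and> engel_horizontal \<Gamma> \<longrightarrow>
              measure lebesgue {t \<in> {0..1}. \<gamma> t = \<Gamma> t} < \<epsilon>)"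
proof -
  obtain q :: "nat \<Rightarrow> real" where q: "\<And>a b. a < b \<Longrightarrow> \<exists>n. a < q n \<and> q n < b"
    using ex_dense_sequence by blast
  \<comment> \<open>The total length of the balls is at most twice the sum of \<open>\<rho>\<close>, which is \<open>4 * c\<close>;
    \<open>c \<le> 1\<close> makes \<open>\<rho> n ^ 3 \<le> \<rho> n\<close>.\<close>
  define c where "c = min 1 (\<epsilon> / 8)"
  define \<rho> where "\<rho> n = c * (1/2) ^ n" for n :: nat
  define r where "r n = \<rho> n ^ 3" for n
  define U where "U = (\<Union>n. ball (q n) (r n))"
  have c: "0 < c" "c \<le> 1" "c \<le> \<epsilon> / 8"
    using assms by (auto simp: c_def)
  have \<rho>0: "0 < \<rho> n" for n
    using c by (simp add: \<rho>_def)
  have \<rho>1: "\<rho> n \<le> 1" for n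
    using mult_mono[of c 1 "(1/2) ^ n" 1] c by (simp add: \<rho>_def power_le_one)
  have \<rho>_sums: "\<rho> sums (c * 2)"
    unfolding \<rho>_def using geometric_sums[of "1/2::real"] by (intro sums_mult) simp
  have s\<rho>: "summable \<rho>"
    using \<rho>_sums by (rule sums_summable)
  have r0: "0 < r n" for n
    using \<rho>0 by (simp add: r_def)
  have r\<rho>: "r n \<le> \<rho> n" for n
    using power_decreasing[of 1 3 "\<rho> n"] \<rho>0[of n] \<rho>1[of n] by (simp add: r_def)
  have r1: "r n \<le> 1" for n
    using r\<rho>[of n] \<rho>1[of n] by simp
  have sr: "summable r"
    by (rule summable_comparison_test'[OF s\<rho>, of 0]) (use r0 r\<rho> in \<open>auto simp: less_imp_le\<close>)
  have openU: "open U"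
    by (auto simp: U_def)
  then have setsU: "U \<in> sets lebesgue"
    by (simp add: borel_open)
  have U: "U \<in> lmeasurable" "measure lebesgue U \<le> (\<Sum>n. 2 * \<rho> n)"
    using measure_union_balls_le[OF setsU, of q r "\<lambda>n. 2 * \<rho> n"] r0 r\<rho> \<rho>0 summable_mult[OF s\<rho>, of 2]
    by (auto simp: U_def less_imp_le)
  have "(\<Sum>n. 2 * \<rho> n) = 4 * c"
    using sums_mult[OF \<rho>_sums, of 2] by (simp add: sums_iff)
  then have U\<epsilon>: "measure lebesgue U < \<epsilon>"
    using U(2) c assms by simp
  obtain f f' :: "real \<Rightarrow> real" and L where
    f: "\<And>t. (f has_real_derivative f' t) (at t)" and f': "\<And>t. \<bar>f' t\<bar> \<le> L"
    and fU: "\<And>t. t \<in> U \<Longrightarrow> 0 < f t" and fK: "\<And>t. t \<notin> U \<Longrightarrow> f t = 0"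
    using differentiable_function_positive_exactly_on_union_of_balls[OF r0 r1 sr, of q, folded U_def] by blast
  define g where "g t = t - 2 * measure lebesgue (U \<inter> {0..t})" for t
  let ?\<gamma> = "engel_curve f g"
  have fd: "(f has_real_derivative f' t) (at t within S)" for t S
    using f by (rule has_field_derivative_at_within)
  have lipf: "L-lipschitz_on {0..1} f"
  proof (rule real_derivative_bound_imp_lipschitz)
    show "0 \<le> L"
      using f'[of 0] by simp
  qed (use fd f' in auto)
  then have contf: "continuous_on {0..1} f"
    by (rule lipschitz_on_continuous_on)
  have lipg: "(1 + \<bar>2\<bar> * 1)-lipschitz_on {0..1} g"
    unfolding g_def
    by (intro lipschitz_on_diff lipschitz_on_cmult_real lipschitz_on_id measure_initial_segment_lipschitz setsU)
  have gU: "(g has_real_derivative -1) (at t within {0..1})" if "t \<in> U" "t \<in> {0..1}" for t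
    unfolding g_def
    by (rule DERIV_cong[OF DERIV_diff[OF DERIV_ident
          DERIV_cmult[OF measure_initial_segment_derivative_inside[OF openU that]]]]) simp
  have gK: "AE t in lebesgue. t \<in> {0..1} \<longrightarrow> t \<notin> U \<longrightarrow> (g has_real_derivative 1) (at t within {0..1})"
    using AE_summable_cube_over_square_distance[OF \<rho>0 \<rho>1 s\<rho>, of q]
  proof eventually_elim
    case (elim t)
    show ?case
    proof (intro impI)
      assume t: "t \<in> {0..1}" "t \<notin> U"
      then have "((\<lambda>s. measure lebesgue (U \<inter> {0..s})) has_real_derivative 0) (at t within {0..1})"
        using elim unfolding U_def r_def
        by (intro measure_initial_segment_derivative_outside) (auto simp: \<rho>0)
      then show "(g has_real_derivative 1) (at t within {0..1})"
        unfolding g_def by (rule DERIV_cong[OF DERIV_diff[OF DERIV_ident DERIV_cmult]]) simp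
    qed
  qed
  then obtain N where N: "N \<in> null_sets lebesgue"
    "\<And>t. t \<in> {0..1} \<Longrightarrow> t \<notin> U \<Longrightarrow> t \<notin> N \<Longrightarrow> (g has_real_derivative 1) (at t within {0..1})"
    by (auto elim!: AE_E3)
  obtain M where lip: "M-lipschitz_on {0..1} ?\<gamma>"
    using engel_curve_lipschitz[OF lipf lipg] by blast
  have "engel_horizontal ?\<gamma>"
    unfolding engel_horizontal_def
  proof
    show "absolutely_continuous_curve_on {0..1} ?\<gamma>"
      using lip by (rule lipschitz_imp_absolutely_continuous_curve_on)
    have "AE t in lebesgue. t \<notin> N"
      using N(1) by (rule AE_not_in)
    then have "AE t in lebesgue. t \<in> {0..1} \<longrightarrow> (\<exists>a b. (?\<gamma> has_vector_derivative
        a *\<^sub>R engel_X1 (?\<gamma> t) + b *\<^sub>R engel_X2 (?\<gamma> t)) (at t within {0..1}))"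
    proof eventually_elim
      case (elim t)
      show ?case
      proof
        assume t: "t \<in> {0..1}"
        \<comment> \<open>Where \<open>x2\<close> moves forward the factor \<open>f t\<close> vanishes, so both cases satisfy the equation.\<close>
        obtain b where "(g has_real_derivative b) (at t within {0..1})" "f t * b = - f t"
        proof (cases "t \<in> U")
          case True
          then show ?thesis
            using that[of "-1"] gU t by simp
        next
          case False
          then show ?thesis
            using that[of 1] N(2) elim t fK by simp
        qed
        then show "\<exists>a b. (?\<gamma> has_vector_derivative
            a *\<^sub>R engel_X1 (?\<gamma> t) + b *\<^sub>R engel_X2 (?\<gamma> t)) (at t within {0..1})"
          using engel_curve_horizontal_velocity[OF fd contf] t by blast
      qed
    qed
    then show "AE t in lebesgue_on {0..1}. \<exists>a b. (?\<gamma> has_vector_derivative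
        a *\<^sub>R engel_X1 (?\<gamma> t) + b *\<^sub>R engel_X2 (?\<gamma> t)) (at t within {0..1})"
      by (simp add: AE_restrict_space_iff)
  qed
  moreover have "measure lebesgue {t \<in> {0..1}. ?\<gamma> t = \<Gamma> t} < \<epsilon>"
    if \<Gamma>: "C1_curve \<Gamma>" "engel_horizontal \<Gamma>" for \<Gamma>
  proof -
    define A where "A = {t \<in> {0..1}. ?\<gamma> t = \<Gamma> t}"
    have "continuous_on {0..1} \<Gamma>"
      using \<Gamma>(1) unfolding C1_curve_def continuous_on_eq_continuous_within
      by (blast intro: has_vector_derivative_continuous)
    then have "closed A"
      using continuous_closed_preimage_constant[of "{0..1}" "\<lambda>t. ?\<gamma> t - \<Gamma> t" 0]
        lipschitz_on_continuous_on[OF lip]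
      by (auto simp: A_def intro!: continuous_on_diff)
    then have setsA: "A \<in> sets lebesgue"
      by (simp add: borel_closed)
    have "countable (A - U - N)"
    proof (rule countable_agreement_at_unit_second_velocity[OF contf _ \<Gamma>])
      show "\<exists>u. s < u \<and> u < t \<and> f u \<noteq> 0" if st: "s < t" for s t
      proof -
        obtain n where n: "s < q n" "q n < t"
          using q[OF st] by blast
        have "q n \<in> U"
          using r0[of n] unfolding U_def by (intro UN_I[of n]) auto
        then show ?thesis
          using n fU[of "q n"] by force
      qed
    qed (auto simp: A_def intro: N(2))
    then have "A - U - N \<in> null_sets lebesgue"
      by (intro null_sets_completionI countable_imp_null_set_lborel)
    then have null: "N \<union> (A - U - N) \<in> null_sets lebesgue"
      by (intro null_sets.Un N(1))
    have "measure lebesgue A \<le> measure lebesgue (U \<union> (N \<union> (A - U - N)))"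
      by (rule measure_mono_fmeasurable) (use setsA fmeasurable.Un[OF U(1) fmeasurableI_null_sets[OF null]] in auto)
    also have "\<dots> = measure lebesgue U"
      by (rule measure_Un_null_set[OF setsU null])
    finally show ?thesis
      using U\<epsilon> by (simp add: A_def)
  qed
  ultimately show ?thesis
    using lip by blast
qed

end
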